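(* Let $X$ be a Hausdorff space. Then $X$ has the fixed point property if and only if $sec(\pi_{2,1}^X)=2$.
   Context: A topological space $X$ has the fixed point property (FPP) if for every continuous self-map $f:X\to X$ there is a point $x\in X$ with $f(x)=x$. The ordered configuration space is $F(X,k)=\{(x_1,\ldots,x_k)\in X^k : x_i\neq x_j \text{ whenever } i\neq j\}$, with the subspace topology from $X^k$; so $F(X,1)=X$. The map $\pi_{2,1}^X:F(X,2)\to X$ is $\pi_{2,1}^X(x_1,x_2)=x_1$. For a continuous map $p:E\to B$, the sectional number $sec(p)$ is the minimal cardinality of open covers of $B$ such that each element $U$ of the cover admits a continuous local section of $p$, i.e. a continuous map $s:U\to E$ such that $p\circ s$ is the inclusion $U\hookrightarrow B$; $sec(p)=\infty$ if no finite such cover exists.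
   Formalization: The formal theorem additionally assumes that X is not a one-point space; for a one-point space the claim is false, since X has the fixed point property but F(X,2) is empty and so sec is infinite. *)

theory Defs
  imports "HOL-Analysis.Analysis" "HOL-Library.Extended_Nat"
begin

definition fixed_point_property :: "'a topology \<Rightarrow> bool" where
  "fixed_point_property X \<longleftrightarrow>
     (\<forall>f. continuous_map X X f \<longrightarrow> (\<exists>x\<in>topspace X. f x = x))"

text \<open>A point of the \<open>k\<close>-fold power is an extensional function on the index set \<open>{1..k}\<close>;
  it lies in the configuration space when its coordinates are pairwise distinct.\<close>

definition config_space :: "'a topology \<Rightarrow> nat \<Rightarrow> (nat \<Rightarrow> 'a) topology" where
  "config_space X k =
     subtopology (product_topology (\<lambda>_. X) {1..k})
       {x. \<forall>i\<in>{1..k}. \<forall>j\<in>{1..k}. i \<noteq> j \<longrightarrow> x i \<noteq> x j}"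

definition config_proj_2_1 :: "(nat \<Rightarrow> 'a) \<Rightarrow> 'a" where
  "config_proj_2_1 x = x 1"

lemma continuous_map_config_proj_2_1:
  "continuous_map (config_space X 2) X config_proj_2_1"
  unfolding config_space_def config_proj_2_1_def
  by (intro continuous_map_from_subtopology continuous_map_product_projection) auto

definition local_section ::
  "'e topology \<Rightarrow> 'b topology \<Rightarrow> ('e \<Rightarrow> 'b) \<Rightarrow> 'b set \<Rightarrow> ('b \<Rightarrow> 'e) \<Rightarrow> bool" where
  "local_section E B p U s \<longleftrightarrow>
     continuous_map (subtopology B U) E s \<and> (\<forall>b\<in>U. p (s b) = b)"

definition sectional_cover ::
  "'e topology \<Rightarrow> 'b topology \<Rightarrow> ('e \<Rightarrow> 'b) \<Rightarrow> 'b set set \<Rightarrow> bool" where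
  "sectional_cover E B p \<U> \<longleftrightarrow>
     \<Union>\<U> = topspace B \<and> (\<forall>U\<in>\<U>. openin B U \<and> (\<exists>s. local_section E B p U s))"

text \<open>The infimum of the empty set in \<^typ>\<open>enat\<close> is \<open>\<infinity>\<close>, which is the required value when
  there is no finite cover. The notion is meant for \<open>p\<close> continuous from \<open>E\<close> to \<open>B\<close>.\<close>

definition sectional_number :: "'e topology \<Rightarrow> 'b topology \<Rightarrow> ('e \<Rightarrow> 'b) \<Rightarrow> enat" where
  "sectional_number E B p = Inf {enat (card \<U>) | \<U>. finite \<U> \<and> sectional_cover E B p \<U>}"

end

theory Submission
  imports Defs
begin

text \<open>
  A local section of \<open>\<pi>\<^sub>2\<^sub>,\<^sub>1\<close> over \<open>U\<close> must keep the first coordinate and is free only in the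
  second one, so it is the same thing as a continuous map \<open>f : U \<rightarrow> X\<close> without fixed points, the
  section being \<open>x \<mapsto> (x, f x)\<close> (\<open>ex_local_section_config_proj_iff\<close>). Over \<open>U = X\<close> this says that
  the fixed point property fails exactly when there is a global section, that is, exactly when the
  sectional number is at most \<open>1\<close> (\<open>sectional_number_le_1_iff\<close>).

  The sectional number is moreover never larger than \<open>2\<close> once \<open>X\<close> has two distinct points \<open>a\<close> and
  \<open>b\<close>: the constant map \<open>a\<close> has no fixed point on \<open>X - {a}\<close>, the constant map \<open>b\<close> has none on
  \<open>X - {b}\<close>, and these two sets are open and cover \<open>X\<close>. This is the only place where separation
  enters, through the closedness of points. Hence the sectional number is \<open>2\<close> precisely when it
  is not at most \<open>1\<close>, which is the fixed point property. The empty space fits the pattern: it lacks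
  the fixed point property and has the (empty) global section.
\<close>

text \<open>The infimum in \<^typ>\<open>enat\<close> is attained as soon as it is finite, because \<^typ>\<open>enat\<close> is
  well-ordered.\<close>

lemma sectional_number_le_enat_iff:
  "sectional_number E B p \<le> enat n \<longleftrightarrow>
    (\<exists>\<U>. finite \<U> \<and> card \<U> \<le> n \<and> sectional_cover E B p \<U>)"
proof
  let ?S = "{enat (card \<U>) | \<U>. finite \<U> \<and> sectional_cover E B p \<U>}"
  assume le: "sectional_number E B p \<le> enat n"
  then have "?S \<noteq> {}"
    unfolding sectional_number_def by (intro notI) (simp add: top_enat_def)
  then have "Inf ?S \<in> ?S"
    unfolding Inf_enat_def by (simp only: if_False) (rule LeastI_ex, blast)
  then have "sectional_number E B p \<in> ?S"
    unfolding sectional_number_def .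
  then obtain \<U> where "finite \<U>" "sectional_cover E B p \<U>"
      "sectional_number E B p = enat (card \<U>)"
    by blast
  with le show "\<exists>\<U>. finite \<U> \<and> card \<U> \<le> n \<and> sectional_cover E B p \<U>"
    by auto
next
  assume "\<exists>\<U>. finite \<U> \<and> card \<U> \<le> n \<and> sectional_cover E B p \<U>"
  then obtain \<U> where "finite \<U>" "card \<U> \<le> n" "sectional_cover E B p \<U>"
    by blast
  then have "sectional_number E B p \<le> enat (card \<U>)"
    unfolding sectional_number_def by (intro Inf_lower) blast
  also have "\<dots> \<le> enat n"
    using \<open>card \<U> \<le> n\<close> by simp
  finally show "sectional_number E B p \<le> enat n" .
qed

lemma sectional_number_le_1_iff:
  "sectional_number E B p \<le> 1 \<longleftrightarrow> (\<exists>s. local_section E B p (topspace B) s)"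
proof
  assume "sectional_number E B p \<le> 1"
  then obtain \<U> where \<U>: "finite \<U>" "card \<U> \<le> 1" "sectional_cover E B p \<U>"
    unfolding one_enat_def sectional_number_le_enat_iff by blast
  then consider "\<U> = {}" | U where "\<U> = {U}"
    by (auto simp: card_le_Suc0_iff_eq)
  then show "\<exists>s. local_section E B p (topspace B) s"
  proof cases
    \<comment> \<open>Only the empty space is covered by the empty family, and over it every map is a section.\<close>
    case 1
    then have "topspace B = {}"
      using \<U>(3) by (simp add: sectional_cover_def)
    then show ?thesis
      by (simp add: local_section_def continuous_map_def)
  next
    case 2
    then show ?thesis
      using \<U>(3) by (auto simp: sectional_cover_def)
  qed
next
  assume "\<exists>s. local_section E B p (topspace B) s"
  then have "sectional_cover E B p {topspace B}"
    by (simp add: sectional_cover_def)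
  then show "sectional_number E B p \<le> 1"
    unfolding one_enat_def sectional_number_le_enat_iff by (intro exI[of _ "{topspace B}"]) simp
qed

text \<open>The second coordinate of a section moves every point of \<open>U\<close>, since configurations have
  distinct entries; conversely the graph of a fixed-point-free map lies in the configuration space.
  The inclusion \<open>U \<subseteq> X\<close> matters because continuity of \<open>s\<close> only controls \<open>s\<close> on \<open>U \<inter> X\<close>.\<close>

lemma ex_local_section_config_proj_iff:
  assumes "U \<subseteq> topspace X"
  shows "(\<exists>s. local_section (config_space X 2) X config_proj_2_1 U s) \<longleftrightarrow>
    (\<exists>f. continuous_map (subtopology X U) X f \<and> (\<forall>x\<in>U. f x \<noteq> x))"
proof
  assume "\<exists>s. local_section (config_space X 2) X config_proj_2_1 U s"
  then obtain s where cont: "continuous_map (subtopology X U) (config_space X 2) s"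
    and sec: "\<forall>x\<in>U. s x 1 = x"
    by (auto simp: local_section_def config_proj_2_1_def)
  have "continuous_map (config_space X 2) X (\<lambda>c. c 2)"
    unfolding config_space_def
    by (intro continuous_map_from_subtopology continuous_map_product_projection) auto
  then have "continuous_map (subtopology X U) X (\<lambda>x. s x 2)"
    using continuous_map_compose[OF cont] by (simp add: comp_def)
  moreover have "s x 2 \<noteq> x" if "x \<in> U" for x
  proof -
    have "s x \<in> topspace (config_space X 2)"
      using cont that assms by (auto simp: continuous_map_def)
    then have "s x 1 \<noteq> s x 2"
      unfolding config_space_def by simp
    then show ?thesis
      using sec that by auto
  qed
  ultimately show "\<exists>f. continuous_map (subtopology X U) X f \<and> (\<forall>x\<in>U. f x \<noteq> x)"
    by blast
next
  assume "\<exists>f. continuous_map (subtopology X U) X f \<and> (\<forall>x\<in>U. f x \<noteq> x)"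
  then obtain f where f: "continuous_map (subtopology X U) X f" "\<And>x. x \<in> U \<Longrightarrow> f x \<noteq> x"
    by blast
  define s where "s = (\<lambda>x. \<lambda>i\<in>{1..2::nat}. if i = 1 then x else f x)"
  have "continuous_map (subtopology X U) X (\<lambda>x. s x i)" if "i \<in> {1..2}" for i
  proof (cases "i = 1")
    case True
    then show ?thesis
      by (simp add: s_def continuous_map_from_subtopology)
  next
    case False
    then show ?thesis
      using that f(1) by (simp add: s_def)
  qed
  then have "continuous_map (subtopology X U) (product_topology (\<lambda>_. X) {1..2}) s"
    by (auto simp: continuous_map_componentwise s_def)
  moreover have "s x i \<noteq> s x j"
    if "x \<in> U" "i \<in> {1..2}" "j \<in> {1..2}" "i \<noteq> j" for x i j
  proof -
    have "i = 1 \<and> j = 2 \<or> i = 2 \<and> j = 1"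
      using that(2-4) by auto
    then show ?thesis
      using f(2)[OF that(1)] by (auto simp: s_def)
  qed
  ultimately have "continuous_map (subtopology X U) (config_space X 2) s"
    unfolding config_space_def continuous_map_in_subtopology by auto
  moreover have "config_proj_2_1 (s x) = x" for x
    by (simp add: config_proj_2_1_def s_def)
  ultimately show "\<exists>s. local_section (config_space X 2) X config_proj_2_1 U s"
    unfolding local_section_def by blast
qed

lemma fixed_point_property_iff_sectional_number_gt_1:
  "fixed_point_property X \<longleftrightarrow>
    \<not> sectional_number (config_space X 2) X config_proj_2_1 \<le> 1"
  unfolding sectional_number_le_1_iff ex_local_section_config_proj_iff[OF order_refl]
  by (auto simp: fixed_point_property_def)

lemma sectional_number_config_proj_le_2:
  assumes "t1_space X" and "\<nexists>a. topspace X = {a}"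
  shows "sectional_number (config_space X 2) X config_proj_2_1 \<le> 2"
proof (cases "topspace X = {}")
  case True
  \<comment> \<open>The empty space has no self-map with a fixed point, so the preceding lemma applies.\<close>
  then have "\<not> fixed_point_property X"
    by (auto simp: fixed_point_property_def intro: continuous_map_id)
  then have "sectional_number (config_space X 2) X config_proj_2_1 \<le> 1"
    by (simp add: fixed_point_property_iff_sectional_number_gt_1)
  then show ?thesis
    by (rule order_trans) simp
next
  case False
  then obtain a where a: "a \<in> topspace X"
    by blast
  moreover have "topspace X \<noteq> {a}"
    using assms(2) by simp
  ultimately obtain b where "b \<in> topspace X" "a \<noteq> b"
    by blast
  note ab = a this
  have piece: "openin X (topspace X - {c}) \<and>
      (\<exists>s. local_section (config_space X 2) X config_proj_2_1 (topspace X - {c}) s)"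
    if "c \<in> topspace X" for c
  proof
    show "openin X (topspace X - {c})"
      using assms(1) that by (simp add: closedin_t1_singleton openin_diff)
    have "continuous_map (subtopology X (topspace X - {c})) X (\<lambda>_. c)"
      using that by simp
    moreover have "\<forall>x\<in>topspace X - {c}. c \<noteq> x"
      by blast
    ultimately show
      "\<exists>s. local_section (config_space X 2) X config_proj_2_1 (topspace X - {c}) s"
      unfolding ex_local_section_config_proj_iff[OF Diff_subset] by blast
  qed
  let ?\<U> = "{topspace X - {a}, topspace X - {b}}"
  have "\<Union>?\<U> = topspace X"
    using ab(3) by auto
  then have "sectional_cover (config_space X 2) X config_proj_2_1 ?\<U>"
    unfolding sectional_cover_def using piece ab(1,2) by blast
  moreover have "card ?\<U> \<le> 2"
    by (simp add: card_insert_if)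
  ultimately have "sectional_number (config_space X 2) X config_proj_2_1 \<le> enat 2"
    unfolding sectional_number_le_enat_iff by (intro exI[of _ ?\<U>]) simp
  then show ?thesis
    by (simp add: numeral_eq_enat)
qed

theorem theorem3p14:
  fixes X :: "'a topology"
  assumes "Hausdorff_space X"
    and "\<nexists>a. topspace X = {a}"
  shows "fixed_point_property X \<longleftrightarrow>
    sectional_number (config_space X 2) X config_proj_2_1 = 2"
proof -
  have le: "sectional_number (config_space X 2) X config_proj_2_1 \<le> 2"
    using sectional_number_config_proj_le_2 Hausdorff_imp_t1_space assms by blast
  have "\<not> n \<le> 1 \<longleftrightarrow> n = 2" if "n \<le> 2" for n :: enat
    using that by (cases n) (auto simp: numeral_eq_enat one_enat_def)
  from this[OF le] show ?thesis
    by (simp only: fixed_point_property_iff_sectional_number_gt_1)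
qed

end
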